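(* Let $\sigma$ and $\pi$ be permutations, and let $m_1=(\sigma,R_1)$ and $m_2=(\sigma,R_2)$ be mesh patterns with the same underlying classical pattern $\sigma$. Regard $\pi=(\pi,\emptyset)$ as a (dominating) classical pattern and assume $|\pi|\le|\sigma|+2$. Suppose there is a box $(a,b)\in[0,|\sigma|]\times[0,|\sigma|]$ such that: 1. $R_2=R_1\cup\{(a,b)\}$; and 2. at least one of the following four conditions holds (where $x,y$ range over $[0,|\sigma|]$): (a)(i) $\pi\preceq\sigma^{(a,b)_a}$, and $(a+1,b)\in G(\sigma)$, and the box $(a+1,b-1)\notin R_1$, and for all $x\ne a,a+1$: $(x,b-1)\in R_1\Rightarrow(x,b)\in R_1$, and for all $y\neq b-1,b$: $(a+1,y)\in R_1\Rightarrow(a,y)\in R_1$; (a)(ii) $\pi\preceq\sigma^{(a,b)_a}$, and $(a,b+1)\in G(\sigma)$, and the box $(a-1,b+1)\notin R_1$, and for all $x\ne a-1,a$: $(x,b+1)\in R_1\Rightarrow(x,b)\in R_1$, and for all $y\neq b,b+1$: $(a-1,y)\in R_1\Rightarrow(a,y)\in R_1$; (b)(i) $\pi\preceq\sigma^{(a,b)_d}$, and $(a+1,b+1)\in G(\sigma)$, and the box $(a+1,b+1)\notin R_1$, and for all $x\ne a,a+1$: $(x,b+1)\in R_1\Rightarrow(x,b)\in R_1$, and for all $y\neq b,b+1$: $(a+1,y)\in R_1\Rightarrow(a,y)\in R_1$; (b)(ii) $\pi\preceq\sigma^{(a,b)_d}$, and $(a,b)\in G(\sigma)$, and the box $(a-1,b-1)\notin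 R_1$, and for all $x\ne a-1,a$: $(x,b-1)\in R_1\Rightarrow(x,b)\in R_1$, and for all $y\neq b-1,b$: $(a-1,y)\in R_1\Rightarrow(a,y)\in R_1$. Then $m_1$ and $m_2$ are coincident under $\pi$, i.e. $\mathrm{Av}(\{\pi,m_1\})=\mathrm{Av}(\{\pi,m_2\})$.
   Context: Write $[n]=\{1,\dots,n\}$ and $[0,k]=\{0,1,\dots,k\}$. A permutation of length $n$ is a bijection of $[n]$, written in one-line notation; $|\sigma|$ is the length of $\sigma$ and $G(\sigma)=\{(i,\sigma(i)) : i\in[n]\}$ is its plot. For permutations, $\sigma\preceq\pi$ means that $\pi$ contains $\sigma$ as a classical pattern, i.e. some subsequence of $\pi$ is order isomorphic to $\sigma$. A mesh pattern of length $k$ is a pair $p=(\tau,R)$ with $\tau$ a permutation of length $k$ (the underlying classical pattern) and $R\subseteq[0,k]\times[0,k]$; the element $(i,j)$ of $[0,k]\times[0,k]$ denotes the unit box with lower left corner $(i,j)$. An occurrence of $p$ in a permutation $\pi$ of length $n$ is a subset $\omega\subseteq G(\pi)$ for which there are order-preserving injections $\alpha,\beta:[k]\to[n]$ such that (i) $\omega=\{(\alpha(i),\beta(j)):(i,j)\in G(\tau)\}$, and (ii) with $\alpha(0)=\beta(0)=0$, $\alpha(k+1)=\beta(k+1)=n+1$ and $R_{ij}=[\alpha(i)+1,\alpha(i+1)-1]\times[\beta(j)+1,\beta(j+1)-1]$, one has $R_{ij}\cap G(\pi)=\emptyset$ for every $(i,j)\in R$. A permutation contains $p$ if it has an occurrence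 of $p$, and avoids $p$ otherwise. A classical pattern $\pi$ is identified with the mesh pattern $(\pi,\emptyset)$. $\mathrm{Av}(S)$ is the set of all permutations (of all lengths) avoiding every pattern in $S$. Two mesh patterns $p_1,p_2$ are coincident under $\pi$ if $\mathrm{Av}(\{\pi,p_1\})=\mathrm{Av}(\{\pi,p_2\})$. For a permutation $\sigma$ of length $n$ and a box $(a,b)\in[0,n]^2$, $\sigma^{(a,b)_a}$ (respectively $\sigma^{(a,b)_d}$) has as underlying permutation the permutation $\sigma'$ of length $n+2$ obtained by inserting an ascent (respectively a descent) in the box $(a,b)$: $\sigma'(a+1)=b+1,\ \sigma'(a+2)=b+2$ (respectively $\sigma'(a+1)=b+2,\ \sigma'(a+2)=b+1$); for $k\le a$, $\sigma'(k)=\sigma(k)$ if $\sigma(k)\le b$ and $\sigma(k)+2$ otherwise; for $k>a+2$, $\sigma'(k)=\sigma(k-2)$ if $\sigma(k-2)\le b$ and $\sigma(k-2)+2$ otherwise. Since $\pi$ is classical, $\pi\preceq\sigma^{(a,b)_a}$ (or $\sigma^{(a,b)_d}$) means that this underlying permutation contains $\pi$ classically. (Subscripts $a$, $d$ on a box stand for "ascent", "descent" and are unrelated to the coordinate $a$.) *)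

theory Defs
  imports Main "HOL-Combinatorics.Permutations"
begin

text \<open>
  A permutation of length \<open>n\<close> is a pair \<open>(n, f)\<close> with \<open>f permutes {1..n}\<close>.  As \<open>permutes\<close> makes
  \<open>f\<close> the identity outside \<open>{1..n}\<close>, every permutation is represented by exactly one such pair.
  The empty permutation is included.
\<close>

type_synonym perm = "nat \<times> (nat \<Rightarrow> nat)"

abbreviation len :: "perm \<Rightarrow> nat" where
  "len \<sigma> \<equiv> fst \<sigma>"

definition is_perm :: "perm \<Rightarrow> bool" where
  "is_perm \<sigma> \<longleftrightarrow> snd \<sigma> permutes {1..len \<sigma>}"

definition plot :: "perm \<Rightarrow> (nat \<times> nat) set" where
  "plot \<sigma> = {(i, snd \<sigma> i) | i. i \<in> {1..len \<sigma>}}"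

text \<open>Here \<open>\<alpha>\<close> selects the positions of a subsequence of \<open>\<pi>\<close> order isomorphic to \<open>\<sigma>\<close>.\<close>

definition pattern_le :: "perm \<Rightarrow> perm \<Rightarrow> bool"  (infix "\<preceq>" 50) where
  "\<sigma> \<preceq> \<pi> \<longleftrightarrow>
     (\<exists>\<alpha>. strict_mono_on {1..len \<sigma>} \<alpha> \<and> \<alpha> ` {1..len \<sigma>} \<subseteq> {1..len \<pi>} \<and>
          (\<forall>i\<in>{1..len \<sigma>}. \<forall>j\<in>{1..len \<sigma>}.
             snd \<sigma> i < snd \<sigma> j \<longleftrightarrow> snd \<pi> (\<alpha> i) < snd \<pi> (\<alpha> j)))"

type_synonym mesh_pattern = "perm \<times> (nat \<times> nat) set"

definition is_mesh_pattern :: "mesh_pattern \<Rightarrow> bool" where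
  "is_mesh_pattern p \<longleftrightarrow>
     is_perm (fst p) \<and> snd p \<subseteq> {0..len (fst p)} \<times> {0..len (fst p)}"

text \<open>
  An order-preserving injection \<open>[k] \<rightarrow> [n]\<close>, already extended by the boundary values at
  \<open>0\<close> and \<open>k + 1\<close>; values beyond \<open>k + 1\<close> are irrelevant.
\<close>

definition embedding :: "nat \<Rightarrow> nat \<Rightarrow> (nat \<Rightarrow> nat) \<Rightarrow> bool" where
  "embedding k n \<alpha> \<longleftrightarrow>
     strict_mono_on {1..k} \<alpha> \<and> \<alpha> ` {1..k} \<subseteq> {1..n} \<and> \<alpha> 0 = 0 \<and> \<alpha> (k + 1) = n + 1"

definition region :: "(nat \<Rightarrow> nat) \<Rightarrow> (nat \<Rightarrow> nat) \<Rightarrow> nat \<Rightarrow> nat \<Rightarrow> (nat \<times> nat) set" where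
  "region \<alpha> \<beta> i j = {\<alpha> i + 1..\<alpha> (i + 1) - 1} \<times> {\<beta> j + 1..\<beta> (j + 1) - 1}"

definition occurrence :: "mesh_pattern \<Rightarrow> perm \<Rightarrow> (nat \<times> nat) set \<Rightarrow> bool" where
  "occurrence p \<pi> \<omega> \<longleftrightarrow> \<omega> \<subseteq> plot \<pi> \<and>
     (\<exists>\<alpha> \<beta>. embedding (len (fst p)) (len \<pi>) \<alpha> \<and> embedding (len (fst p)) (len \<pi>) \<beta> \<and>
        \<omega> = {(\<alpha> i, \<beta> j) | i j. (i, j) \<in> plot (fst p)} \<and>
        (\<forall>(i, j) \<in> snd p. region \<alpha> \<beta> i j \<inter> plot \<pi> = {}))"

definition avoids :: "perm \<Rightarrow> mesh_pattern \<Rightarrow> bool" where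
  "avoids \<pi> p \<longleftrightarrow> \<not> (\<exists>\<omega>. occurrence p \<pi> \<omega>)"

definition Av :: "mesh_pattern set \<Rightarrow> perm set" where
  "Av S = {\<pi>. is_perm \<pi> \<and> (\<forall>p\<in>S. avoids \<pi> p)}"

definition coincident_under :: "perm \<Rightarrow> mesh_pattern \<Rightarrow> mesh_pattern \<Rightarrow> bool" where
  "coincident_under \<pi> p1 p2 \<longleftrightarrow> Av {(\<pi>, {}), p1} = Av {(\<pi>, {}), p2}"

text \<open>
  Inserting into the box \<open>(a, b)\<close> two adjacent points with values \<open>u\<close>, \<open>v\<close>, where
  \<open>{u, v} = {b + 1, b + 2}\<close>.  No case distinction on \<open>k\<close> outside \<open>{1..n + 2}\<close> is needed: for
  \<open>a, b \<le> n\<close> the same formula is the identity there.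
\<close>

definition insert_two :: "perm \<Rightarrow> nat \<Rightarrow> nat \<Rightarrow> nat \<Rightarrow> nat \<Rightarrow> perm" where
  "insert_two \<sigma> a b u v =
     (len \<sigma> + 2,
      \<lambda>k. let shift = (\<lambda>y. if y \<le> b then y else y + 2) in
          if k \<le> a then shift (snd \<sigma> k)
          else if k = a + 1 then u
          else if k = a + 2 then v
          else shift (snd \<sigma> (k - 2)))"

definition insert_ascent :: "perm \<Rightarrow> nat \<Rightarrow> nat \<Rightarrow> perm" where
  "insert_ascent \<sigma> a b = insert_two \<sigma> a b (b + 1) (b + 2)"

definition insert_descent :: "perm \<Rightarrow> nat \<Rightarrow> nat \<Rightarrow> perm" where
  "insert_descent \<sigma> a b = insert_two \<sigma> a b (b + 2) (b + 1)"

end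

(*
  Let \<tau> avoid \<pi> and contain (\<sigma>, R1), and suppose the box (a, b) of an occurrence is not empty.  All
  four conditions say that \<sigma> has a point (c, d) at a corner of (a, b); write (a', b') for the box
  opposite to (a, b) at that corner.  Since \<tau> avoids \<pi>, the points in (a, b) form a monotone
  sequence running towards the corner.  Moving the corner point to the point p of this sequence that
  is farthest from the corner empties (a, b), and pushes the rest of the sequence and the old corner
  point into (a', b'), which is not shaded.  Column a' and row b' otherwise only absorb parts of
  column a and row b, so the remaining hypotheses keep all shaded boxes empty.
*)

theory Submission
  imports Defs
begin

section \<open>Boxes, plots and extended embeddings\<close>

text \<open>A box is the product of two gaps, one per axis, so facts about grid lines can be proved
  for a single axis and used for columns and rows alike. Strict inequalities avoid the subtraction
  in \<open>region\<close>.\<close>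

definition gap :: "(nat \<Rightarrow> nat) \<Rightarrow> nat \<Rightarrow> nat \<Rightarrow> bool" where
  "gap \<alpha> i z \<longleftrightarrow> \<alpha> i < z \<and> z < \<alpha> (i + 1)"

lemma mem_region_iff: "(x, y) \<in> region \<alpha> \<beta> i j \<longleftrightarrow> gap \<alpha> i x \<and> gap \<beta> j y"
  unfolding region_def gap_def by auto

lemma mem_plot_iff: "(x, y) \<in> plot \<sigma> \<longleftrightarrow> x \<in> {1..len \<sigma>} \<and> y = snd \<sigma> x"
  unfolding plot_def by auto

lemma plot_in_range:
  assumes "is_perm \<sigma>" "(x, y) \<in> plot \<sigma>"
  shows "x \<in> {1..len \<sigma>}" "y \<in> {1..len \<sigma>}"
  using assms permutes_in_image[of "snd \<sigma>" "{1..len \<sigma>}" x] unfolding is_perm_def mem_plot_iff by auto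

lemma plot_inj:
  assumes "is_perm \<sigma>" "(x, y) \<in> plot \<sigma>" "(x', y') \<in> plot \<sigma>"
  shows "x = x' \<longleftrightarrow> y = y'"
  using assms permutes_inj[of "snd \<sigma>" "{1..len \<sigma>}"] unfolding is_perm_def mem_plot_iff
  by (auto dest: injD)

lemma embedding_less:
  assumes "embedding k n \<alpha>" "i < j" "j \<le> k + 1"
  shows "\<alpha> i < \<alpha> j"
proof -
  have sm: "strict_mono_on {1..k} \<alpha>" and im: "\<And>l. l \<in> {1..k} \<Longrightarrow> \<alpha> l \<in> {1..n}"
    and ends: "\<alpha> 0 = 0" "\<alpha> (k + 1) = n + 1"
    using assms(1) unfolding embedding_def by (auto simp: image_subset_iff simp del: atLeastAtMost_iff)
  consider "i = 0" "j = k + 1" | "i = 0" "j \<in> {1..k}" | "i \<in> {1..k}" "j = k + 1"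
    | "i \<in> {1..k}" "j \<in> {1..k}"
    using assms(2,3) by fastforce
  then show ?thesis
  proof cases
    case 4
    then show ?thesis using strict_mono_onD[OF sm] assms(2) by blast
  qed (use im[of i] im[of j] ends in auto)
qed

text \<open>Steps between neighbours compose to strict monotonicity on \<open>{0..k + 1}\<close>,
  and comparison with the values at \<open>0\<close> and \<open>k + 1\<close> confines the inner
  values to \<open>{1..n}\<close>.\<close>

lemma embeddingI:
  assumes "\<And>i. i \<le> k \<Longrightarrow> \<alpha> i < \<alpha> (i + 1)" "\<alpha> 0 = 0" "\<alpha> (k + 1) = n + 1"
  shows "embedding k n \<alpha>"
proof -
  have less: "\<alpha> i < \<alpha> j" if "i < j" "j \<le> k + 1" for i j
    using that
  proof (induction j)
    case (Suc j)
    then show ?case using assms(1)[of j] by (cases "i = j") auto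
  qed simp
  have "\<alpha> i \<in> {1..n}" if "i \<in> {1..k}" for i
    using less[of 0 i] less[of i "k + 1"] that assms(2,3) by auto
  then show ?thesis
    unfolding embedding_def using less assms(2,3) by (auto intro!: strict_mono_onI)
qed

text \<open>By monotonicity \<open>\<alpha> c\<close> is at most \<open>\<alpha> i\<close> or at
  least \<open>\<alpha> (i + 1)\<close>. Hence the points of an occurrence lie in no open box of its
  own grid.\<close>

lemma gap_not_value:
  assumes "embedding k n \<alpha>" "i \<le> k" "c \<le> k + 1"
  shows "\<not> gap \<alpha> i (\<alpha> c)"
proof (cases "c \<le> i")
  case True
  then show ?thesis using embedding_less[OF assms(1), of c i] assms unfolding gap_def
    by (cases "c = i") auto
next
  case False
  then show ?thesis using embedding_less[OF assms(1), of "i + 1" c] assms unfolding gap_def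
    by (cases "c = i + 1") auto
qed

section \<open>Occurrences as pairs of embeddings\<close>

text \<open>The set \<open>\<omega>\<close> is determined by the two embeddings, so the quantifier
  over it disappears (\<open>one_point\<close>), and emptiness of the shaded boxes becomes a
  statement about single points.\<close>

lemma contains_iff:
  "\<not> avoids \<tau> (\<sigma>, R) \<longleftrightarrow>
    (\<exists>\<alpha> \<beta>. embedding (len \<sigma>) (len \<tau>) \<alpha> \<and> embedding (len \<sigma>) (len \<tau>) \<beta> \<and>
      (\<forall>i j. (i, j) \<in> plot \<sigma> \<longrightarrow> (\<alpha> i, \<beta> j) \<in> plot \<tau>) \<and>
      (\<forall>i j x y. (i, j) \<in> R \<longrightarrow> (x, y) \<in> plot \<tau> \<longrightarrow> gap \<alpha> i x \<longrightarrow> gap \<beta> j y \<longrightarrow> False))"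
    (is "_ \<longleftrightarrow> (\<exists>\<alpha> \<beta>. ?P \<alpha> \<beta>)")
proof -
  have empty_iff: "(\<forall>(i, j)\<in>R. region \<alpha> \<beta> i j \<inter> plot \<tau> = {}) \<longleftrightarrow>
    (\<forall>i j x y. (i, j) \<in> R \<longrightarrow> (x, y) \<in> plot \<tau> \<longrightarrow> gap \<alpha> i x \<longrightarrow> gap \<beta> j y \<longrightarrow> False)" for \<alpha> \<beta>
    by (auto simp: disjoint_iff mem_region_iff)
  have subset_iff: "{(\<alpha> i, \<beta> j) | i j. (i, j) \<in> plot \<sigma>} \<subseteq> plot \<tau> \<longleftrightarrow>
    (\<forall>i j. (i, j) \<in> plot \<sigma> \<longrightarrow> (\<alpha> i, \<beta> j) \<in> plot \<tau>)" for \<alpha> \<beta> :: "nat \<Rightarrow> nat"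
    by blast
  have one_point: "(\<exists>\<omega>. \<omega> \<subseteq> P \<and> (\<exists>\<alpha> \<beta>. A \<alpha> \<and> B \<beta> \<and> \<omega> = S \<alpha> \<beta> \<and> D \<alpha> \<beta>)) \<longleftrightarrow>
      (\<exists>\<alpha> \<beta>. A \<alpha> \<and> B \<beta> \<and> S \<alpha> \<beta> \<subseteq> P \<and> D \<alpha> \<beta>)"
    for P :: "'p set" and A :: "'u \<Rightarrow> bool" and B :: "'v \<Rightarrow> bool" and S D
    by blast
  have "(\<exists>\<omega>. occurrence (\<sigma>, R) \<tau> \<omega>) \<longleftrightarrow> (\<exists>\<alpha> \<beta>. ?P \<alpha> \<beta>)"
    unfolding occurrence_def fst_conv snd_conv one_point empty_iff subset_iff ..
  then show ?thesis unfolding avoids_def by (simp only: not_not)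
qed

lemma avoids_mono:
  assumes "avoids \<tau> (\<sigma>, R)" "R \<subseteq> S"
  shows "avoids \<tau> (\<sigma>, S)"
proof -
  have "occurrence (\<sigma>, R) \<tau> \<omega>" if "occurrence (\<sigma>, S) \<tau> \<omega>" for \<omega>
    using that assms(2) unfolding occurrence_def fst_conv snd_conv
    by (elim conjE exE) (intro conjI exI; (assumption | blast))
  then show ?thesis using assms(1) unfolding avoids_def by blast
qed

section \<open>Classical containment\<close>

lemma pattern_le_trans:
  assumes "\<rho> \<preceq> \<sigma>" "\<sigma> \<preceq> \<tau>"
  shows "\<rho> \<preceq> \<tau>"
proof -
  obtain \<alpha> where \<alpha>: "strict_mono_on {1..len \<rho>} \<alpha>" "\<alpha> ` {1..len \<rho>} \<subseteq> {1..len \<sigma>}"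
    "\<forall>i\<in>{1..len \<rho>}. \<forall>j\<in>{1..len \<rho>}.
      snd \<rho> i < snd \<rho> j \<longleftrightarrow> snd \<sigma> (\<alpha> i) < snd \<sigma> (\<alpha> j)"
    using assms(1) unfolding pattern_le_def by (elim exE conjE)
  obtain \<gamma> where \<gamma>: "strict_mono_on {1..len \<sigma>} \<gamma>" "\<gamma> ` {1..len \<sigma>} \<subseteq> {1..len \<tau>}"
    "\<forall>i\<in>{1..len \<sigma>}. \<forall>j\<in>{1..len \<sigma>}.
      snd \<sigma> i < snd \<sigma> j \<longleftrightarrow> snd \<tau> (\<gamma> i) < snd \<tau> (\<gamma> j)"
    using assms(2) unfolding pattern_le_def by (elim exE conjE)
  have mem: "\<alpha> i \<in> {1..len \<sigma>}" if "i \<in> {1..len \<rho>}" for i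
    using \<alpha>(2) that by blast
  show ?thesis
    unfolding pattern_le_def
  proof (intro exI conjI ballI)
    show "strict_mono_on {1..len \<rho>} (\<gamma> \<circ> \<alpha>)"
      using strict_mono_onD[OF \<gamma>(1) mem mem] strict_mono_onD[OF \<alpha>(1)]
      by (intro strict_mono_onI) (simp only: comp_def)
    show "(\<gamma> \<circ> \<alpha>) ` {1..len \<rho>} \<subseteq> {1..len \<tau>}"
      using mem \<gamma>(2) by (auto simp only: comp_def image_subset_iff)
    show "snd \<rho> i < snd \<rho> j \<longleftrightarrow> snd \<tau> ((\<gamma> \<circ> \<alpha>) i) < snd \<tau> ((\<gamma> \<circ> \<alpha>) j)"
      if "i \<in> {1..len \<rho>}" "j \<in> {1..len \<rho>}" for i j
      using \<alpha>(3)[rule_format, OF that] \<gamma>(3)[rule_format, OF mem[OF that(1)] mem[OF that(2)]] by simp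
  qed
qed

text \<open>Containment supplies only the embedding of columns. The embedding of rows is recovered
  through the inverse of \<open>\<rho>\<close>, and order isomorphism makes it increasing.\<close>

lemma pattern_le_imp_contains:
  assumes "is_perm \<rho>" "is_perm \<tau>" "\<rho> \<preceq> \<tau>"
  shows "\<not> avoids \<tau> (\<rho>, {})"
proof -
  let ?k = "len \<rho>" and ?n = "len \<tau>"
  obtain \<alpha> where \<alpha>: "strict_mono_on {1..?k} \<alpha>" "\<alpha> ` {1..?k} \<subseteq> {1..?n}"
    "\<forall>i\<in>{1..?k}. \<forall>j\<in>{1..?k}.
      snd \<rho> i < snd \<rho> j \<longleftrightarrow> snd \<tau> (\<alpha> i) < snd \<tau> (\<alpha> j)"
    using assms(3) unfolding pattern_le_def by (elim exE conjE)
  have \<rho>: "snd \<rho> permutes {1..?k}" and \<tau>: "snd \<tau> permutes {1..?n}"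
    using assms unfolding is_perm_def by auto
  define r where "r = inv (snd \<rho>)"
  have r: "r j \<in> {1..?k}" "snd \<rho> (r j) = j" if "j \<in> {1..?k}" for j
    using permutes_in_image[OF permutes_inv[OF \<rho>], of j] permutes_inverses(1)[OF \<rho>] that
    unfolding r_def by auto
  have r_left: "r (snd \<rho> i) = i" for i
    using permutes_inverses(2)[OF \<rho>] unfolding r_def by auto
  \<comment> \<open>An embedding has prescribed values at \<open>0\<close> and
    \<open>?k + 1\<close>, where pattern containment says nothing about
    \<open>\<alpha>\<close>.\<close>
  define extend :: "(nat \<Rightarrow> nat) \<Rightarrow> nat \<Rightarrow> nat" where
    "extend = (\<lambda>f. f(0 := 0, ?k + 1 := ?n + 1))"
  have extend_eq: "extend f i = f i" if "i \<in> {1..?k}" for f i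
    using that unfolding extend_def by auto
  have ext: "embedding ?k ?n (extend f)"
    if "strict_mono_on {1..?k} f" "f ` {1..?k} \<subseteq> {1..?n}" for f
  proof -
    have "strict_mono_on {1..?k} (extend f)"
      using that(1) unfolding strict_mono_on_def by (simp add: extend_eq)
    moreover have "extend f ` {1..?k} \<subseteq> {1..?n}"
      using that(2) extend_eq[of _ f] by (metis (no_types, lifting) image_cong)
    ultimately show ?thesis
      unfolding embedding_def by (simp add: extend_def)
  qed
  \<comment> \<open>Row \<open>j\<close> of \<open>\<rho>\<close> holds the point in column
    \<open>r j\<close>; its image in \<open>\<tau>\<close> determines the row that \<open>j\<close>
    is sent to.\<close>
  let ?\<beta> = "\<lambda>j. snd \<tau> (\<alpha> (r j))"
  have "strict_mono_on {1..?k} ?\<beta>"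
  proof (rule strict_mono_onI)
    fix i j assume "i \<in> {1..?k}" "j \<in> {1..?k}" "i < j"
    then show "?\<beta> i < ?\<beta> j" using \<alpha>(3)[rule_format, of "r i" "r j"] r by auto
  qed
  moreover have "?\<beta> ` {1..?k} \<subseteq> {1..?n}"
    using \<alpha>(2) r(1) permutes_in_image[OF \<tau>] by blast
  ultimately have "embedding ?k ?n (extend ?\<beta>)" by (rule ext)
  moreover have "embedding ?k ?n (extend \<alpha>)" using \<alpha>(1,2) by (rule ext)
  moreover have "(extend \<alpha> i, extend ?\<beta> j) \<in> plot \<tau>" if "(i, j) \<in> plot \<rho>" for i j
    using that plot_in_range[OF assms(1) that] \<alpha>(2) extend_eq
    by (auto simp: mem_plot_iff r_left image_subset_iff)
  ultimately show ?thesis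
    unfolding contains_iff by blast
qed

section \<open>Inserting two points into a box\<close>

text \<open>The selected grid lines together with two new ones, \<open>s\<close> and
  \<open>t\<close>, inside gap \<open>a\<close>. The numbering matches that of
  \<open>insert_two\<close>: lines above \<open>a\<close> are shifted by two.\<close>

definition widen :: "(nat \<Rightarrow> nat) \<Rightarrow> nat \<Rightarrow> nat \<Rightarrow> nat \<Rightarrow> nat \<Rightarrow> nat" where
  "widen \<alpha> a s t k =
    (if k \<le> a then \<alpha> k else if k = a + 1 then s else if k = a + 2 then t else \<alpha> (k - 2))"

lemma embedding_widen:
  assumes "embedding k n \<alpha>" "a \<le> k" "gap \<alpha> a s" "gap \<alpha> a t" "s < t"
  shows "embedding (k + 2) n (widen \<alpha> a s t)"
proof (rule embeddingI)
  fix i assume "i \<le> k + 2"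
  consider "i < a" | "i = a" | "i = a + 1" | "i = a + 2" | "i > a + 2" by linarith
  then show "widen \<alpha> a s t i < widen \<alpha> a s t (i + 1)"
  proof cases
    case 5
    then have "Suc (i - 2) = i - 1" by simp
    then show ?thesis
      using 5 \<open>i \<le> k + 2\<close> embedding_less[OF assms(1), of "i - 2" "i - 1"] by (simp add: widen_def)
  qed (use assms embedding_less[OF assms(1), of i "i + 1"] in \<open>auto simp: widen_def gap_def\<close>)
qed (use assms in \<open>auto simp: widen_def embedding_def\<close>)

text \<open>The occurrence of \<open>\<sigma>\<close> together with two points of its box
  \<open>(a, b)\<close> is a copy of \<open>\<sigma>\<close> with an ascent or a descent inserted,
  according to which of the two points is higher.\<close>

lemma insert_two_pattern_le:
  assumes "is_perm \<sigma>" "a \<le> len \<sigma>" "b \<le> len \<sigma>"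
    and \<alpha>: "embedding (len \<sigma>) (len \<tau>) \<alpha>" and \<beta>: "embedding (len \<sigma>) (len \<tau>) \<beta>"
    and occ: "\<And>i j. (i, j) \<in> plot \<sigma> \<Longrightarrow> (\<alpha> i, \<beta> j) \<in> plot \<tau>"
    and p: "(px, py) \<in> plot \<tau>" "gap \<alpha> a px" "gap \<beta> b py"
    and q: "(qx, qy) \<in> plot \<tau>" "gap \<alpha> a qx" "gap \<beta> b qy"
    and "px < qx"
    and uv: "u = b + 1 \<and> v = b + 2 \<and> py < qy \<or> u = b + 2 \<and> v = b + 1 \<and> qy < py"
  shows "insert_two \<sigma> a b u v \<preceq> \<tau>"
proof -
  let ?\<iota> = "insert_two \<sigma> a b u v"
  \<comment> \<open>The new columns are ordered by \<open>px < qx\<close>, but the order of the new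
    rows depends on the kind of insertion, hence \<open>min\<close> and \<open>max\<close>.\<close>
  let ?\<gamma> = "widen \<alpha> a px qx" and ?\<delta> = "widen \<beta> b (min py qy) (max py qy)"
  have len: "len ?\<iota> = len \<sigma> + 2" by (simp add: insert_two_def)
  have \<gamma>: "embedding (len ?\<iota>) (len \<tau>) ?\<gamma>"
    unfolding len by (rule embedding_widen) (use assms in auto)
  have \<delta>: "embedding (len ?\<iota>) (len \<tau>) ?\<delta>"
    unfolding len
    by (rule embedding_widen) (use assms in \<open>auto simp: min_def max_def\<close>)
  \<comment> \<open>The grid maps send the plot of \<open>?\<iota>\<close> into that of
    \<open>\<tau>\<close>, so comparing values of \<open>\<tau>\<close> reduces to strict
    monotonicity of \<open>?\<delta>\<close>.\<close>
  have key: "snd ?\<iota> i \<in> {1..len ?\<iota>} \<and> snd \<tau> (?\<gamma> i) = ?\<delta> (snd ?\<iota> i)"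
    if i: "i \<in> {1..len ?\<iota>}" for i
  proof -
    have old: "snd \<sigma> l \<in> {1..len \<sigma>}" "snd \<tau> (\<alpha> l) = \<beta> (snd \<sigma> l)" if "l \<in> {1..len \<sigma>}" for l
      using that plot_in_range[OF assms(1), of l "snd \<sigma> l"] occ[of l "snd \<sigma> l"]
      by (auto simp: mem_plot_iff)
    consider "i \<le> a" | "i = a + 1" | "i = a + 2" | "i > a + 2" by linarith
    then show ?thesis
    proof cases
      case 1
      then show ?thesis using old[of i] i assms(2)
        by (auto simp: insert_two_def widen_def Let_def)
    next
      case 4
      then have "i - 2 \<in> {1..len \<sigma>}" using i len by auto
      then show ?thesis using 4 old[of "i - 2"]
        by (auto simp: insert_two_def widen_def Let_def)
    qed (use uv p(1) q(1) assms(2,3) in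
        \<open>auto simp: insert_two_def widen_def mem_plot_iff min_def max_def\<close>)
  qed
  show ?thesis
    unfolding pattern_le_def
  proof (intro exI conjI ballI)
    show "strict_mono_on {1..len ?\<iota>} ?\<gamma>" "?\<gamma> ` {1..len ?\<iota>} \<subseteq> {1..len \<tau>}"
      using \<gamma> unfolding embedding_def by auto
    fix i j assume "i \<in> {1..len ?\<iota>}" "j \<in> {1..len ?\<iota>}"
    moreover have "strict_mono_on {1..len ?\<iota>} ?\<delta>"
      using \<delta> unfolding embedding_def by auto
    ultimately show "snd ?\<iota> i < snd ?\<iota> j \<longleftrightarrow> snd \<tau> (?\<gamma> i) < snd \<tau> (?\<gamma> j)"
      using key by (simp add: strict_mono_on_less)
  qed
qed

section \<open>Moving one grid line into an adjacent gap\<close>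

text \<open>
  Lines \<open>a\<close> and \<open>a'\<close> are neighbours and \<open>max a a'\<close> is the index of their common boundary, so that
  both the positive and the negative direction are covered at once.
\<close>

locale boundary_move =
  fixes k n :: nat and \<alpha> :: "nat \<Rightarrow> nat" and a a' z :: nat
  assumes emb: "embedding k n \<alpha>"
    and adjacent: "a' = a + 1 \<or> a = a' + 1"
    and inner: "max a a' \<le> k"
    and gap_z: "gap \<alpha> a z"
begin

abbreviation "\<alpha>' \<equiv> \<alpha>(max a a' := z)"

lemma less_step: "i \<le> k \<Longrightarrow> \<alpha> i < \<alpha> (i + 1)"
  using embedding_less[OF emb, of i "i + 1"] by simp

text \<open>The moved line has an index between \<open>1\<close> and \<open>k\<close>, so both
  boundary values stay fixed, and \<open>z\<close> lies strictly between the two neighbouring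
  lines.\<close>

lemma embedding_moved: "embedding k n \<alpha>'"
proof (rule embeddingI)
  fix i assume "i \<le> k"
  show "\<alpha>' i < \<alpha>' (i + 1)"
    using adjacent inner gap_z less_step[OF \<open>i \<le> k\<close>] less_step[of a] less_step[of a']
    by (auto simp: gap_def max_def split: if_splits)
qed (use emb adjacent inner in \<open>auto simp: embedding_def max_def\<close>)

lemma gap_moved_other: "gap \<alpha>' i x \<Longrightarrow> i \<noteq> a \<Longrightarrow> i \<noteq> a' \<Longrightarrow> gap \<alpha> i x"
  using adjacent by (auto simp: gap_def max_def split: if_splits)

text \<open>Gap \<open>a\<close> keeps only its part beyond \<open>z\<close>, seen from the old
  line, while the new gap \<open>a'\<close> stops at \<open>z\<close>.\<close>

lemma gap_moved_old:
  assumes "gap \<alpha>' a x"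
  shows "gap \<alpha> a x" "\<not> gap \<alpha>' a' x" "x \<noteq> z"
  using adjacent gap_z assms by (auto simp: gap_def max_def split: if_splits)

text \<open>Gap \<open>a'\<close> is extended up to \<open>z\<close> and so absorbs the old line and
  the part of gap \<open>a\<close> between that line and \<open>z\<close>.\<close>

lemma gap_moved_new:
  assumes "gap \<alpha>' a' x"
  shows "gap \<alpha> a' x \<or> x = \<alpha> (max a a') \<or> gap \<alpha> a x"
  using adjacent gap_z assms by (auto simp: gap_def max_def split: if_splits)

lemma gap_moved_newI:
  assumes "gap \<alpha> a x" "if a < a' then z < x else x < z"
  shows "gap \<alpha>' a' x"
  using adjacent assms inner less_step[of a'] by (auto simp: gap_def max_def split: if_splits)

end

section \<open>Moving the corner point\<close>

text \<open>By \<open>far\<close>, \<open>p\<close> is extreme in both coordinates, so every other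
  point of the old box \<open>(a, b)\<close> lands in the unshaded box \<open>(a', b')\<close>. The
  nine cases, by whether a column is \<open>a\<close>, \<open>a'\<close> or another and likewise for
  rows, trace a point of a shaded new box back to the old grid.\<close>

lemma contains_move:
  assumes "is_perm \<sigma>" "is_perm \<tau>" "R \<subseteq> {0..len \<sigma>} \<times> {0..len \<sigma>}"
    and \<alpha>: "embedding (len \<sigma>) (len \<tau>) \<alpha>" and \<beta>: "embedding (len \<sigma>) (len \<tau>) \<beta>"
    and occ: "\<And>i j. (i, j) \<in> plot \<sigma> \<Longrightarrow> (\<alpha> i, \<beta> j) \<in> plot \<tau>"
    and empty: "\<And>i j x y. (i, j) \<in> R \<Longrightarrow> (x, y) \<in> plot \<tau> \<Longrightarrow> gap \<alpha> i x \<Longrightarrow> gap \<beta> j y \<Longrightarrow> False"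
    and adj: "a' = a + 1 \<or> a = a' + 1" "b' = b + 1 \<or> b = b' + 1"
    and corner: "(max a a', max b b') \<in> plot \<sigma>"
    and unshaded: "(a', b') \<notin> R"
    and rows: "\<And>x. x \<le> len \<sigma> \<Longrightarrow> x \<noteq> a \<Longrightarrow> x \<noteq> a' \<Longrightarrow> (x, b') \<in> R \<Longrightarrow> (x, b) \<in> R"
    and cols: "\<And>y. y \<le> len \<sigma> \<Longrightarrow> y \<noteq> b \<Longrightarrow> y \<noteq> b' \<Longrightarrow> (a', y) \<in> R \<Longrightarrow> (a, y) \<in> R"
    and p: "(px, py) \<in> plot \<tau>" "gap \<alpha> a px" "gap \<beta> b py"
    and far: "\<And>x y. (x, y) \<in> plot \<tau> \<Longrightarrow> gap \<alpha> a x \<Longrightarrow> gap \<beta> b y \<Longrightarrow> x \<noteq> px \<Longrightarrow>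
      (if a < a' then px < x else x < px) \<and> (if b < b' then py < y else y < py)"
  shows "\<not> avoids \<tau> (\<sigma>, insert (a, b) R)"
proof -
  let ?c = "max a a'" and ?d = "max b b'"
  have range: "?c \<in> {1..len \<sigma>}" "?d \<in> {1..len \<sigma>}"
    using plot_in_range[OF assms(1) corner] by auto
  interpret X: boundary_move "len \<sigma>" "len \<tau>" \<alpha> a a' px
    using \<alpha> adj p range by unfold_locales auto
  interpret Y: boundary_move "len \<sigma>" "len \<tau>" \<beta> b b' py
    using \<beta> adj p range by unfold_locales auto
  \<comment> \<open>No other point of \<open>\<sigma>\<close> shares a column or a row with the
    corner, so moving both lines changes the image of the corner only, which becomes
    \<open>p\<close>.\<close>
  have "(X.\<alpha>' i, Y.\<alpha>' j) \<in> plot \<tau>" if "(i, j) \<in> plot \<sigma>" for i j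
    using plot_inj[OF assms(1) that corner] occ[OF that] p(1) by auto
  moreover have False
    if ij: "(i, j) \<in> insert (a, b) R" and xy: "(x, y) \<in> plot \<tau>"
      and gx: "gap X.\<alpha>' i x" and gy: "gap Y.\<alpha>' j y" for i j x y
  proof -
    have le: "i \<le> len \<sigma>" "j \<le> len \<sigma>"
      using ij assms(3) range by auto
    \<comment> \<open>A point on one of the two old lines is the old corner and thus lies on both;
      with \<open>not_c\<close> and \<open>not_d\<close> it is then in no old gap of either
      axis.\<close>
    have corner_iff: "x = \<alpha> ?c \<longleftrightarrow> y = \<beta> ?d"
      using plot_inj[OF assms(2) xy occ[OF corner]] .
    have p_iff: "x = px \<longleftrightarrow> y = py"
      using plot_inj[OF assms(2) xy p(1)] .
    have not_c: "\<not> gap \<alpha> l (\<alpha> ?c)" if "l \<le> len \<sigma>" for l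
      using gap_not_value[OF \<alpha> that] range by auto
    have not_d: "\<not> gap \<beta> l (\<beta> ?d)" if "l \<le> len \<sigma>" for l
      using gap_not_value[OF \<beta> that] range by auto
    have ab: "a \<le> len \<sigma>" "b \<le> len \<sigma>" using range by auto
    have far': "gap X.\<alpha>' a' x \<and> gap Y.\<alpha>' b' y" if "gap \<alpha> a x" "gap \<beta> b y" "x \<noteq> px"
      using far[OF xy that] X.gap_moved_newI[OF that(1)] Y.gap_moved_newI[OF that(2)] by blast
    have ne: "a' \<noteq> a" "b' \<noteq> b" using adj by auto
    consider "i = a" | "i = a'" | "i \<noteq> a" "i \<noteq> a'" by blast
    then show False
    proof cases
      case 1
      then have x: "gap \<alpha> a x" "\<not> gap X.\<alpha>' a' x" "x \<noteq> px"
        using X.gap_moved_old gx by auto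
      consider "j = b" | "j = b'" | "j \<noteq> b" "j \<noteq> b'" by blast
      then show False
      proof cases
        case 1
        then show False using far' x Y.gap_moved_old(1) gy by blast
      next
        case 2
        \<comment> \<open>A point here comes from the old box \<open>(a, b')\<close>, which is
          empty, or from the old line of the corner, which bounds column \<open>a\<close>, or from
          the old box \<open>(a, b)\<close>; in the last case it is not \<open>p\<close> and has
          left column \<open>a\<close>.\<close>
        then have "(a, b') \<in> R" using ij \<open>i = a\<close> ne by auto
        then show False
          using Y.gap_moved_new gy 2 far' x empty[OF _ xy] corner_iff not_c[OF ab(1)] by blast
      next
        case 3
        then show False using Y.gap_moved_other[OF gy] ij \<open>i = a\<close> x empty[OF _ xy] by blast
      qed
    next
      case 2
      consider "j = b" | "j = b'" | "j \<noteq> b" "j \<noteq> b'" by blast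
      then show False
      proof cases
        case 1
        then have y: "gap \<beta> b y" "\<not> gap Y.\<alpha>' b' y" "y \<noteq> py"
          using Y.gap_moved_old gy by auto
        have "(a', b) \<in> R" using ij 1 2 ne by auto
        then show False
          using X.gap_moved_new gx 2 far' y p_iff empty[OF _ xy] corner_iff not_d[OF ab(2)]
          by blast
      next
        case 2
        then show False using ij unshaded \<open>i = a'\<close> ne by auto
      next
        case 3
        \<comment> \<open>Column \<open>a'\<close> has absorbed part of column \<open>a\<close>;
          \<open>cols\<close> makes the old box \<open>(a, j)\<close> shaded too, so that part
          contributes no point.\<close>
        then have "gap \<beta> j y" "(a', j) \<in> R" "(a, j) \<in> R"
          using Y.gap_moved_other[OF gy] ij \<open>i = a'\<close> cols le by auto
        then show False
          using X.gap_moved_new gx \<open>i = a'\<close> empty[OF _ xy] corner_iff not_d[OF le(2)] by blast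
      qed
    next
      case 3
      then have x: "gap \<alpha> i x" and R: "(i, j) \<in> R" using X.gap_moved_other[OF gx] ij by auto
      consider "j = b" | "j = b'" | "j \<noteq> b" "j \<noteq> b'" by blast
      then show False
      proof cases
        case 1
        then show False using Y.gap_moved_old(1) gy x R empty[OF _ xy] by blast
      next
        case 2
        \<comment> \<open>Likewise \<open>rows\<close> covers the part of row \<open>b\<close> that
          row \<open>b'\<close> has absorbed.\<close>
        then have "(i, b) \<in> R" using rows R 3 le by auto
        then show False
          using Y.gap_moved_new gy 2 R x empty[OF _ xy] corner_iff not_c[OF le(1)] by blast
      next
        case 3
        then show False using Y.gap_moved_other[OF gy] R x empty[OF _ xy] by blast
      qed
    qed
  qed
  ultimately show ?thesis
    unfolding contains_iff using X.embedding_moved Y.embedding_moved by blast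
qed

section \<open>Coincidence for a corner in any direction\<close>

text \<open>
  The four conditions of the theorem are the choices of \<open>a'\<close> and \<open>b'\<close>, with an ascent inserted if
  the two directions differ and a descent if they agree.
\<close>

lemma coincident_under_corner:
  assumes "is_perm \<sigma>" "is_perm \<pi>" "R \<subseteq> {0..len \<sigma>} \<times> {0..len \<sigma>}"
    and adj: "a' = a + 1 \<or> a = a' + 1" "b' = b + 1 \<or> b = b' + 1"
    and corner: "(max a a', max b b') \<in> plot \<sigma>"
    and unshaded: "(a', b') \<notin> R"
    and rows: "\<And>x. x \<le> len \<sigma> \<Longrightarrow> x \<noteq> a \<Longrightarrow> x \<noteq> a' \<Longrightarrow> (x, b') \<in> R \<Longrightarrow> (x, b) \<in> R"
    and cols: "\<And>y. y \<le> len \<sigma> \<Longrightarrow> y \<noteq> b \<Longrightarrow> y \<noteq> b' \<Longrightarrow> (a', y) \<in> R \<Longrightarrow> (a, y) \<in> R"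
    and insertion: "\<pi> \<preceq> (if (a < a') = (b < b') then insert_descent \<sigma> a b else insert_ascent \<sigma> a b)"
  shows "coincident_under \<pi> (\<sigma>, R) (\<sigma>, insert (a, b) R)"
proof -
  have ab: "a \<le> len \<sigma>" "b \<le> len \<sigma>"
    using plot_in_range[OF assms(1) corner] by auto
  have "avoids \<tau> (\<sigma>, R)"
    if \<tau>: "is_perm \<tau>" and av\<pi>: "avoids \<tau> (\<pi>, {})" and av: "avoids \<tau> (\<sigma>, insert (a, b) R)" for \<tau>
  proof (rule ccontr)
    assume "\<not> avoids \<tau> (\<sigma>, R)"
    then obtain \<alpha> \<beta> where
      \<alpha>: "embedding (len \<sigma>) (len \<tau>) \<alpha>" and \<beta>: "embedding (len \<sigma>) (len \<tau>) \<beta>"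
      and occ: "\<And>i j. (i, j) \<in> plot \<sigma> \<Longrightarrow> (\<alpha> i, \<beta> j) \<in> plot \<tau>"
      and empty: "\<And>i j x y. (i, j) \<in> R \<Longrightarrow> (x, y) \<in> plot \<tau> \<Longrightarrow> gap \<alpha> i x \<Longrightarrow> gap \<beta> j y \<Longrightarrow> False"
      unfolding contains_iff by blast
    \<comment> \<open>The points of the box are recorded by their columns alone, so that
      \<open>Min\<close> and \<open>Max\<close> can pick an extreme one.\<close>
    define B where "B = {x. gap \<alpha> a x \<and> gap \<beta> b (snd \<tau> x) \<and> (x, snd \<tau> x) \<in> plot \<tau>}"
    have "finite B"
      by (rule finite_subset[of _ "{1..len \<tau>}"]) (auto simp: B_def mem_plot_iff)
    \<comment> \<open>With an empty box, the occurrence of \<open>(\<sigma>, R)\<close> would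
      already be one of the pattern with \<open>(a, b)\<close> shaded.\<close>
    have "B \<noteq> {}"
    proof
      assume "B = {}"
      then have "(x, y) \<in> plot \<tau> \<Longrightarrow> gap \<alpha> a x \<Longrightarrow> gap \<beta> b y \<Longrightarrow> False" for x y
        unfolding B_def by (auto simp: mem_plot_iff)
      then have "\<not> avoids \<tau> (\<sigma>, insert (a, b) R)"
        unfolding contains_iff using \<alpha> \<beta> occ empty by blast
      then show False using av by blast
    qed
    \<comment> \<open>Two points in the opposite order would complete the occurrence of
      \<open>\<sigma>\<close> to the permutation given by \<open>insertion\<close>, which contains
      \<open>\<pi>\<close>.\<close>
    have monotone: "snd \<tau> x < snd \<tau> y \<longleftrightarrow> (a < a') = (b < b')" if "x \<in> B" "y \<in> B" "x < y" for x y
    proof (rule ccontr)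
      assume neq: "\<not> ?thesis"
      have "snd \<tau> x \<noteq> snd \<tau> y"
        using that plot_inj[OF \<tau>, of x "snd \<tau> x" y "snd \<tau> y"] unfolding B_def by auto
      then have "(if (a < a') = (b < b') then insert_descent \<sigma> a b else insert_ascent \<sigma> a b) \<preceq> \<tau>"
        using neq that insert_two_pattern_le[OF assms(1) ab \<alpha> \<beta> occ, of x "snd \<tau> x" y "snd \<tau> y"]
        unfolding B_def insert_descent_def insert_ascent_def by auto
      then show False
        using pattern_le_imp_contains[OF assms(2) \<tau>] pattern_le_trans[OF insertion] av\<pi> by blast
    qed
    \<comment> \<open>The point horizontally farthest from the corner; by \<open>monotone\<close> it
      is also the vertically farthest one.\<close>
    define p where "p = (if a < a' then Min B else Max B)"
    have "p \<in> B"
      using \<open>finite B\<close> \<open>B \<noteq> {}\<close> unfolding p_def by auto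
    have far: "(if a < a' then p < x else x < p) \<and>
        (if b < b' then snd \<tau> p < snd \<tau> x else snd \<tau> x < snd \<tau> p)" if "x \<in> B" "x \<noteq> p" for x
    proof -
      have "if a < a' then p < x else x < p"
        using that \<open>finite B\<close> unfolding p_def by (auto simp: less_le)
      moreover have "snd \<tau> x \<noteq> snd \<tau> p"
        using that \<open>p \<in> B\<close> plot_inj[OF \<tau>, of x "snd \<tau> x" p "snd \<tau> p"] unfolding B_def by auto
      ultimately show ?thesis
        using monotone[OF that(1) \<open>p \<in> B\<close>] monotone[OF \<open>p \<in> B\<close> that(1)]
        by (auto split: if_splits)
    qed
    have p: "(p, snd \<tau> p) \<in> plot \<tau>" "gap \<alpha> a p" "gap \<beta> b (snd \<tau> p)"
      using \<open>p \<in> B\<close> unfolding B_def by auto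
    have "\<not> avoids \<tau> (\<sigma>, insert (a, b) R)"
    proof (rule contains_move[OF assms(1) \<tau> assms(3) \<alpha> \<beta> _ _ adj corner unshaded _ _ p])
      fix x y assume "(x, y) \<in> plot \<tau>" "gap \<alpha> a x" "gap \<beta> b y" "x \<noteq> p"
      moreover from this have "x \<in> B" "y = snd \<tau> x"
        unfolding B_def by (auto simp: mem_plot_iff)
      ultimately show "(if a < a' then p < x else x < p) \<and>
          (if b < b' then snd \<tau> p < y else y < snd \<tau> p)"
        using far by simp
    qed (use occ empty rows cols in blast)+
    then show False using av by blast
  qed
  moreover have "avoids \<tau> (\<sigma>, insert (a, b) R)" if "avoids \<tau> (\<sigma>, R)" for \<tau>
    using avoids_mono[OF that] by blast
  ultimately show ?thesis
    unfolding coincident_under_def Av_def by blast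
qed

section \<open>The four corner conditions\<close>

theorem proposition3p8:
  fixes \<sigma> \<pi> :: perm and R1 R2 :: "(nat \<times> nat) set" and a b :: nat
  assumes "is_perm \<sigma>" and "is_perm \<pi>"
    and "is_mesh_pattern (\<sigma>, R1)" and "is_mesh_pattern (\<sigma>, R2)"
    and "len \<pi> \<le> len \<sigma> + 2"
    and "(a, b) \<in> {0..len \<sigma>} \<times> {0..len \<sigma>}"
    and "R2 = R1 \<union> {(a, b)}"
    and "(\<pi> \<preceq> insert_ascent \<sigma> a b \<and> (a + 1, b) \<in> plot \<sigma> \<and> (a + 1, b - 1) \<notin> R1 \<and>
          (\<forall>x\<in>{0..len \<sigma>}. x \<noteq> a \<and> x \<noteq> a + 1 \<longrightarrow> (x, b - 1) \<in> R1 \<longrightarrow> (x, b) \<in> R1) \<and>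
          (\<forall>y\<in>{0..len \<sigma>}. y \<noteq> b - 1 \<and> y \<noteq> b \<longrightarrow> (a + 1, y) \<in> R1 \<longrightarrow> (a, y) \<in> R1))
       \<or> (\<pi> \<preceq> insert_ascent \<sigma> a b \<and> (a, b + 1) \<in> plot \<sigma> \<and> (a - 1, b + 1) \<notin> R1 \<and>
          (\<forall>x\<in>{0..len \<sigma>}. x \<noteq> a - 1 \<and> x \<noteq> a \<longrightarrow> (x, b + 1) \<in> R1 \<longrightarrow> (x, b) \<in> R1) \<and>
          (\<forall>y\<in>{0..len \<sigma>}. y \<noteq> b \<and> y \<noteq> b + 1 \<longrightarrow> (a - 1, y) \<in> R1 \<longrightarrow> (a, y) \<in> R1))
       \<or> (\<pi> \<preceq> insert_descent \<sigma> a b \<and> (a + 1, b + 1) \<in> plot \<sigma> \<and> (a + 1, b + 1) \<notin> R1 \<and>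
          (\<forall>x\<in>{0..len \<sigma>}. x \<noteq> a \<and> x \<noteq> a + 1 \<longrightarrow> (x, b + 1) \<in> R1 \<longrightarrow> (x, b) \<in> R1) \<and>
          (\<forall>y\<in>{0..len \<sigma>}. y \<noteq> b \<and> y \<noteq> b + 1 \<longrightarrow> (a + 1, y) \<in> R1 \<longrightarrow> (a, y) \<in> R1))
       \<or> (\<pi> \<preceq> insert_descent \<sigma> a b \<and> (a, b) \<in> plot \<sigma> \<and> (a - 1, b - 1) \<notin> R1 \<and>
          (\<forall>x\<in>{0..len \<sigma>}. x \<noteq> a - 1 \<and> x \<noteq> a \<longrightarrow> (x, b - 1) \<in> R1 \<longrightarrow> (x, b) \<in> R1) \<and>
          (\<forall>y\<in>{0..len \<sigma>}. y \<noteq> b - 1 \<and> y \<noteq> b \<longrightarrow> (a - 1, y) \<in> R1 \<longrightarrow> (a, y) \<in> R1))"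
  shows "coincident_under \<pi> (\<sigma>, R1) (\<sigma>, R2)"
proof -
  have R: "R1 \<subseteq> {0..len \<sigma>} \<times> {0..len \<sigma>}"
    using assms(3) unfolding is_mesh_pattern_def by auto
  have R2: "R2 = insert (a, b) R1"
    using assms(7) by auto
  note corner = coincident_under_corner[OF assms(1,2) R, of _ a _ b]
  \<comment> \<open>Coordinates of plotted points are at least 1. Wherever \<open>a - 1\<close> or
    \<open>b - 1\<close> occurs, the corner point therefore rules out truncation, and the box is a
    genuine neighbour.\<close>
  note range = plot_in_range[OF assms(1)]
  show ?thesis
    unfolding R2 using assms(8)
  proof (elim disjE conjE, goal_cases)
    case 1
    then show ?case using range[OF 1(2)] by (intro corner[of "a + 1" "b - 1"]) (auto simp: max_def)
  next
    case 2
    then show ?case using range[OF 2(2)] by (intro corner[of "a - 1" "b + 1"]) (auto simp: max_def)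
  next
    case 3
    then show ?case by (intro corner[of "a + 1" "b + 1"]) (auto simp: max_def)
  next
    case 4
    then show ?case using range[OF 4(2)] by (intro corner[of "a - 1" "b - 1"]) (auto simp: max_def)
  qed
qed

end
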